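(* Let $H$ be an induced subgraph of a graph $G$ and let $v$ be a vertex of $H$. Then the zeros of $\beta(G,x)_{[H-v]}$ interlace the zeros of $\beta(G,x)_{[H]}$. In particular, if $H$ is connected, then the largest zero of $\beta(G,x)_{[H]}$ has multiplicity $1$ and is greater than the largest zero of $\beta(G,x)_{[H-v]}$.
   Context: All graphs are finite, undirected, without loops or multiple edges. $d_G(v)$ is the degree of $v$ in $G$; $\mathcal{M}(H)$ is the set of matchings of $H$ including the empty set; $V(M)$ is the set of endpoints of edges of $M$. For an induced subgraph $H$ of $G$, the principal Laplacian matching polynomial of $G$ with respect to $H$ is $\beta(G,x)_{[H]}=\sum_{M\in\mathcal{M}(H)}(-1)^{|M|}\prod_{v\in V(H)\setminus V(M)}(x-d_G(v))$ (degrees taken in $G$); for $H$ empty it equals $1$. $H-v$ is the induced subgraph of $G$ on $V(H)\setminus\{v\}$. These polynomials are real-rooted. If $f$ has zeros $\alpha_1\le\dots\le\alpha_{h-1}$ and $g$ has zeros $\beta_1\le\dots\le\beta_h$, the zeros of $f$ interlace those of $g$ if $\beta_1\le\alpha_1\le\beta_2\le\dots\le\alpha_{h-1}\le\beta_h$. *)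

theory Defs
  imports Complex_Main "HOL-Computational_Algebra.Computational_Algebra"
begin

record 'a graph =
  verts :: "'a set"
  edges :: "'a set set"

definition simple_graph :: "'a graph \<Rightarrow> bool" where
  "simple_graph G \<longleftrightarrow>
     finite (verts G) \<and> (\<forall>e\<in>edges G. e \<subseteq> verts G \<and> card e = 2)"

definition degree_in :: "'a graph \<Rightarrow> 'a \<Rightarrow> nat" where
  "degree_in G v = card {e \<in> edges G. v \<in> e}"

definition induced :: "'a graph \<Rightarrow> 'a set \<Rightarrow> 'a graph" where
  "induced G S = \<lparr>verts = S, edges = {e \<in> edges G. e \<subseteq> S}\<rparr>"

definition induced_subgraph :: "'a graph \<Rightarrow> 'a graph \<Rightarrow> bool" where
  "induced_subgraph H G \<longleftrightarrow> verts H \<subseteq> verts G \<and> H = induced G (verts H)"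

definition connected_graph :: "'a graph \<Rightarrow> bool" where
  "connected_graph G \<longleftrightarrow> verts G \<noteq> {} \<and>
     (\<forall>u\<in>verts G. \<forall>w\<in>verts G. (u, w) \<in> {(a, b). {a, b} \<in> edges G}\<^sup>*)"

definition matchings :: "'a graph \<Rightarrow> 'a set set set" where
  "matchings H = {M. M \<subseteq> edges H \<and> (\<forall>e\<in>M. \<forall>f\<in>M. e \<noteq> f \<longrightarrow> e \<inter> f = {})}"

text \<open>The principal Laplacian matching polynomial of \<open>G\<close> with respect to \<open>H\<close>. The
  matchings are those of \<open>H\<close>, but the degrees are taken in \<open>G\<close>; \<open>[:- c, 1:]\<close> is \<open>x - c\<close>.\<close>

definition plmp :: "'a graph \<Rightarrow> 'a graph \<Rightarrow> real poly" where
  "plmp G H = (\<Sum>M\<in>matchings H. (- 1) ^ card M *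
     (\<Prod>v\<in>verts H - \<Union>M. [:- real (degree_in G v), 1:]))"

definition real_rooted :: "real poly \<Rightarrow> bool" where
  "real_rooted p \<longleftrightarrow> p \<noteq> 0 \<and> (\<forall>z::complex. poly (map_poly of_real p) z = 0 \<longrightarrow> z \<in> \<real>)"

text \<open>The real zeros in nondecreasing order, repeated according to multiplicity; these are all
  the zeros if the polynomial is real-rooted.\<close>

definition zeros :: "real poly \<Rightarrow> real list" where
  "zeros p = sorted_list_of_multiset (proots p)"

text \<open>The zeros of \<open>f\<close> interlace those of \<open>g\<close>. With 0-based indices \<open>zeros f ! i\<close> is
  \<open>\<alpha>\<^sub>i\<^sub>+\<^sub>1\<close> and \<open>zeros g ! i\<close> is \<open>\<beta>\<^sub>i\<^sub>+\<^sub>1\<close>. Both polynomials are required to be real-rooted,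
  so that no zeros are left out of account.\<close>

definition interlace :: "real poly \<Rightarrow> real poly \<Rightarrow> bool" where
  "interlace f g \<longleftrightarrow> real_rooted f \<and> real_rooted g \<and>
     length (zeros g) = length (zeros f) + 1 \<and>
     (\<forall>i<length (zeros f). zeros g ! i \<le> zeros f ! i \<and> zeros f ! i \<le> zeros g ! (i + 1))"

text \<open>Meaningful only for polynomials with at least one and finitely many real zeros.\<close>

definition largest_zero :: "real poly \<Rightarrow> real" where
  "largest_zero p = Max {x. poly p x = 0}"

end

theory Submission
  imports Defs
begin

text \<open>
  Write \<open>pl S\<close> for the polynomial of the subgraph induced by \<open>S\<close>. Expanding along the matchings at
  \<open>v\<close> gives \<open>pl S = (x - d v) pl (S - v) - (\<Sum>u. pl (S - v - u))\<close>, the sum ranging over the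
  neighbours \<open>u\<close> of \<open>v\<close> in \<open>S\<close>. Hence, by induction, \<open>pl S / pl (S - v)\<close> maps the upper half
  plane to itself, and \<open>pl S\<close> is real-rooted. The argument of this quotient is a difference of sums
  of angles \<open>arg (z - \<beta>)\<close>, which therefore stays between \<open>0\<close> and \<open>\<pi>\<close>; letting \<open>z\<close> tend to a real
  \<open>t\<close>, each zero above \<open>t\<close> contributes \<open>\<pi>\<close>, so \<open>pl S\<close> has at least as many zeros above \<open>t\<close> as
  \<open>pl (S - v)\<close> and at most one more. This is interlacing with multiplicities. For connected \<open>S\<close>, the
  recurrence at the largest zero of \<open>pl S\<close> shows that it is not a zero of \<open>pl (S - v)\<close>, and
  interlacing then makes it simple.
\<close>

section \<open>Real-rooted polynomials and their linear factors\<close>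

abbreviation cpoly :: "real poly \<Rightarrow> complex poly" where
  "cpoly p \<equiv> map_poly complex_of_real p"

lemma cpoly_add: "cpoly (p + q) = cpoly p + cpoly q"
  by (intro poly_eqI) (simp add: coeff_map_poly)

lemma cpoly_diff: "cpoly (p - q) = cpoly p - cpoly q"
  by (intro poly_eqI) (simp add: coeff_map_poly)

lemma cpoly_mult: "cpoly (p * q) = cpoly p * cpoly q"
  by (intro poly_eqI) (simp add: coeff_map_poly coeff_mult)

lemma cpoly_sum: "cpoly (sum f A) = (\<Sum>x\<in>A. cpoly (f x))"
  by (induction A rule: infinite_finite_induct) (simp_all add: cpoly_add)

lemma cpoly_linear: "cpoly [:- c, 1:] = [:- complex_of_real c, 1:]"
  by (simp add: map_poly_pCons)

lemma poly_cpoly_cnj: "poly (cpoly p) (cnj z) = cnj (poly (cpoly p) z)"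
  by (rule poly_cnj_real[symmetric]) (simp add: coeff_map_poly)

lemma poly_cpoly_of_real: "poly (cpoly p) (complex_of_real x) = complex_of_real (poly p x)"
  by (induction p) (simp_all add: map_poly_pCons)

text \<open>Non-real zeros of a real polynomial come in conjugate pairs, so it is enough to exclude
  the open upper half plane.\<close>

lemma real_rootedI:
  assumes "\<And>z. Im z > 0 \<Longrightarrow> poly (cpoly p) z \<noteq> 0"
  shows "real_rooted p"
  unfolding real_rooted_def
proof (intro conjI allI impI)
  show "p \<noteq> 0" using assms[of \<i>] by auto
  fix z assume z: "poly (cpoly p) z = 0"
  have "\<not> Im z > 0" using assms z by blast
  moreover have "\<not> Im (cnj z) > 0"
    using assms[of "cnj z"] z by (auto simp: poly_cpoly_cnj)
  ultimately show "z \<in> \<real>" by (simp add: complex_is_Real_iff)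
qed

text \<open>The fundamental theorem of algebra supplies a zero, which is real by hypothesis; the
  quotient by its linear factor is again monic and real-rooted.\<close>

lemma real_rooted_factorization:
  assumes "real_rooted p" "lead_coeff p = 1"
  shows "\<exists>A. p = (\<Prod>\<alpha>\<in>#A. [:- \<alpha>, 1:])"
  using assms
proof (induction "degree p" arbitrary: p)
  case 0
  then have "p = 1" by (auto elim!: degree_eq_zeroE)
  then show ?case by (intro exI[of _ "{#}"]) simp
next
  case (Suc n)
  have "degree (cpoly p) = Suc n" using Suc.hyps by (simp add: degree_map_poly)
  then have "\<not> constant (poly (cpoly p))" by (simp add: constant_degree)
  then obtain z where z: "poly (cpoly p) z = 0"
    using fundamental_theorem_of_algebra by blast
  then have "z \<in> \<real>" using Suc.prems by (auto simp: real_rooted_def)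
  then obtain r where "z = complex_of_real r" by (auto elim: Reals_cases)
  then have "poly p r = 0" using z by (simp add: poly_cpoly_of_real)
  then obtain q where q: "p = [:- r, 1:] * q" by (auto simp: poly_eq_0_iff_dvd)
  have "q \<noteq> 0" using q Suc.hyps by auto
  then have deg: "n = degree q" using Suc.hyps q degree_mult_eq[of "[:- r, 1:]" q] by simp
  have "lead_coeff q = 1" using Suc.prems(2) q by (simp only: lead_coeff_mult) simp
  moreover have "real_rooted q"
    using Suc.prems(1) \<open>q \<noteq> 0\<close> unfolding real_rooted_def q cpoly_mult by simp
  ultimately obtain A where "q = (\<Prod>\<alpha>\<in>#A. [:- \<alpha>, 1:])" using Suc.hyps(1) deg by blast
  then show ?case using q by (intro exI[of _ "add_mset r A"]) simp
qed

lemma proots_prod_linear: "proots (\<Prod>\<alpha>\<in>#A. [:- \<alpha>, 1:]) = (A :: real multiset)"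
proof (induction A)
  case (add a A)
  have "(\<Prod>\<alpha>\<in>#A. [:- \<alpha>, 1:]) \<noteq> (0 :: real poly)" by auto
  then have "proots ([:- a, 1:] * (\<Prod>\<alpha>\<in>#A. [:- \<alpha>, 1:])) = add_mset a A"
    using add by (subst proots_mult) (auto simp del: mult_pCons_left)
  then show ?case by (simp del: mult_pCons_left)
qed simp

lemma real_rooted_eq_prod_proots:
  assumes "real_rooted p" "lead_coeff p = 1"
  shows "p = (\<Prod>\<alpha>\<in>#proots p. [:- \<alpha>, 1:])"
proof -
  obtain A where "p = (\<Prod>\<alpha>\<in>#A. [:- \<alpha>, 1:])" using real_rooted_factorization[OF assms] by blast
  then show ?thesis by (simp add: proots_prod_linear)
qed

section \<open>Arguments of products of linear factors in the upper half plane\<close>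

text \<open>For \<open>y > 0\<close> each summand is the argument, in \<open>(0, pi)\<close>, of the
  complex number \<open>Complex (t - \<alpha>) y\<close>. Summing without reduction modulo
  \<open>2 * pi\<close> gives a branch that is continuous in \<open>t\<close> and counts zeros in
  the limit.\<close>

definition phase :: "real multiset \<Rightarrow> real \<Rightarrow> real \<Rightarrow> real" where
  "phase A y t = (\<Sum>\<alpha>\<in>#A. pi / 2 - arctan ((t - \<alpha>) / y))"

lemma Complex_polar:
  assumes "y > 0"
  shows "\<exists>r>0. Complex x y = complex_of_real r * cis (pi / 2 - arctan (x / y))"
proof (intro exI conjI)
  \<comment> \<open>This is the modulus, written so that it cancels the square roots in
    \<open>sin_arctan\<close> and \<open>cos_arctan\<close>.\<close>
  let ?r = "y * sqrt (1 + (x / y)\<^sup>2)"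
  have pos: "sqrt (1 + (x / y)\<^sup>2) > 0" by (simp add: add_pos_nonneg)
  then show "?r > 0" using assms by simp
  show "Complex x y = complex_of_real ?r * cis (pi / 2 - arctan (x / y))"
    using assms pos
    by (simp add: complex_eq_iff cos_diff sin_diff sin_arctan cos_arctan)
qed

lemma poly_prod_linear_polar:
  assumes "y > 0"
  shows "\<exists>r>0. poly (cpoly (\<Prod>\<alpha>\<in>#A. [:- \<alpha>, 1:])) (Complex t y) = complex_of_real r * cis (phase A y t)"
proof (induction A)
  case empty
  then show ?case by (auto simp: phase_def intro!: exI[of _ 1])
next
  case (add a A)
  then obtain r where r: "r > 0"
    "poly (cpoly (\<Prod>\<alpha>\<in>#A. [:- \<alpha>, 1:])) (Complex t y) = complex_of_real r * cis (phase A y t)"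
    by blast
  obtain s where s: "s > 0" "Complex (t - a) y = complex_of_real s * cis (pi / 2 - arctan ((t - a) / y))"
    using Complex_polar[OF assms] by blast
  have "poly (cpoly (\<Prod>\<alpha>\<in>#add_mset a A. [:- \<alpha>, 1:])) (Complex t y) =
      poly (cpoly [:- a, 1:]) (Complex t y) * poly (cpoly (\<Prod>\<alpha>\<in>#A. [:- \<alpha>, 1:])) (Complex t y)"
    by (simp only: image_mset_add_mset prod_mset.add_mset cpoly_mult poly_mult)
  also have "poly (cpoly [:- a, 1:]) (Complex t y) = Complex (t - a) y"
    unfolding cpoly_linear by (simp add: complex_eq_iff)
  finally have "poly (cpoly (\<Prod>\<alpha>\<in>#add_mset a A. [:- \<alpha>, 1:])) (Complex t y) =
      complex_of_real (s * r) * cis (phase (add_mset a A) y t)"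
    unfolding r s phase_def by (simp add: cis_mult[symmetric])
  then show ?case using r s by (intro exI[of _ "s * r"]) simp
qed

lemma continuous_on_phase: "continuous_on S (phase A y)"
proof (induction A)
  case empty
  then show ?case by (simp add: phase_def)
next
  case (add a A)
  have "phase (add_mset a A) y = (\<lambda>t. (pi / 2 - arctan ((t - a) / y)) + phase A y t)"
    by (auto simp: phase_def)
  moreover have "continuous_on S (\<lambda>t. (pi / 2 - arctan ((t - a) / y)) + phase A y t)"
    unfolding divide_inverse by (intro continuous_intros add)
  ultimately show ?case by simp
qed

text \<open>This fixes the branch: far to the right every factor has argument close to 0.\<close>

lemma phase_at_top:
  assumes "y > 0"
  shows "(phase A y \<longlongrightarrow> 0) at_top"
proof (induction A)
  case empty
  then show ?case by (simp add: phase_def[abs_def])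
next
  case (add a A)
  have "filterlim (\<lambda>t. - a + t) at_top at_top"
    by (rule filterlim_tendsto_add_at_top[OF tendsto_const filterlim_ident])
  then have "filterlim (\<lambda>t. (- a + t) * inverse y) at_top at_top"
    using assms by (simp add: filterlim_at_top_mult_tendsto_pos[OF tendsto_const])
  then have "filterlim (\<lambda>t. (t - a) / y) at_top at_top"
    by (simp add: divide_inverse)
  then have "((\<lambda>t. arctan ((t - a) / y)) \<longlongrightarrow> pi / 2) at_top"
    by (rule filterlim_compose[OF tendsto_arctan_at_top])
  then have "((\<lambda>t. (pi / 2 - arctan ((t - a) / y)) + phase A y t) \<longlongrightarrow> (pi / 2 - pi / 2) + 0) at_top"
    by (intro tendsto_intros add)
  then show ?case by (simp add: phase_def)
qed

text \<open>With \<open>x = t - \<alpha>\<close> this is the contribution of one zero at the point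
  with real part \<open>t + 1/n\<close> and imaginary part \<open>1/n^2\<close>. The term linear in
  \<open>n\<close> decides the case \<open>x = 0\<close>, sending it to 0.\<close>

lemma arctan_scaled_limit:
  fixes x :: real
  shows "(\<lambda>n. pi / 2 - arctan (x * (real n)\<^sup>2 + real n)) \<longlonglongrightarrow> (if x < 0 then pi else 0)"
proof (cases "x < 0")
  case True
  have "filterlim (\<lambda>n. x + inverse (real n)) (nhds (x + 0)) sequentially"
    by (intro tendsto_intros lim_inverse_n)
  moreover have "filterlim (\<lambda>n. (real n)\<^sup>2) at_top sequentially"
    by (intro filterlim_pow_at_top filterlim_real_sequentially) simp
  ultimately have "filterlim (\<lambda>n. (x + inverse (real n)) * (real n)\<^sup>2) at_bot sequentially"
    using True by (intro filterlim_tendsto_neg_mult_at_bot[where c = x]) auto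
  moreover have "(x + inverse (real n)) * (real n)\<^sup>2 = x * (real n)\<^sup>2 + real n" for n
    by (cases "n = 0") (simp_all add: field_simps power2_eq_square)
  ultimately have "filterlim (\<lambda>n. x * (real n)\<^sup>2 + real n) at_bot sequentially" by simp
  then have "(\<lambda>n. arctan (x * (real n)\<^sup>2 + real n)) \<longlonglongrightarrow> - (pi / 2)"
    by (rule filterlim_compose[OF tendsto_arctan_at_bot])
  then have "(\<lambda>n. pi / 2 - arctan (x * (real n)\<^sup>2 + real n)) \<longlonglongrightarrow> pi / 2 - - (pi / 2)"
    by (intro tendsto_intros)
  then show ?thesis using True by simp
next
  case False
  then have "filterlim (\<lambda>n. x * (real n)\<^sup>2 + real n) at_top sequentially"
    by (intro filterlim_at_top_mono[OF filterlim_real_sequentially]) (auto intro!: always_eventually)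
  then have "(\<lambda>n. arctan (x * (real n)\<^sup>2 + real n)) \<longlonglongrightarrow> pi / 2"
    by (rule filterlim_compose[OF tendsto_arctan_at_top])
  then have "(\<lambda>n. pi / 2 - arctan (x * (real n)\<^sup>2 + real n)) \<longlonglongrightarrow> pi / 2 - pi / 2"
    by (intro tendsto_intros)
  then show ?thesis using False by simp
qed

text \<open>The point \<open>t + 1/n + \<i>/n\<^sup>2\<close> tends to \<open>t\<close> almost horizontally from the right, so that
  the zeros equal to \<open>t\<close> do not contribute to the limit.\<close>

lemma phase_limit:
  "(\<lambda>n. phase A (inverse ((real n)\<^sup>2)) (t + inverse (real n)))
     \<longlonglongrightarrow> pi * real (size (filter_mset (\<lambda>\<alpha>. t < \<alpha>) A))"
proof (induction A)
  case empty
  then show ?case by (simp add: phase_def)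
next
  case (add a A)
  \<comment> \<open>At \<open>n = 0\<close> both sides are 0, since division by zero yields
    0.\<close>
  have eq: "(t + inverse (real n) - a) / inverse ((real n)\<^sup>2) = (t - a) * (real n)\<^sup>2 + real n" for n
    by (cases "n = 0") (simp_all add: field_simps power2_eq_square)
  have "(\<lambda>n. (pi / 2 - arctan ((t - a) * (real n)\<^sup>2 + real n)) +
       phase A (inverse ((real n)\<^sup>2)) (t + inverse (real n)))
     \<longlonglongrightarrow> (if t - a < 0 then pi else 0) + pi * real (size (filter_mset (\<lambda>\<alpha>. t < \<alpha>) A))"
    by (intro tendsto_add arctan_scaled_limit add)
  moreover have "(if t - a < 0 then pi else 0) + pi * real (size (filter_mset (\<lambda>\<alpha>. t < \<alpha>) A)) =
      pi * real (size (filter_mset (\<lambda>\<alpha>. t < \<alpha>) (add_mset a A)))"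
    by (simp add: algebra_simps)
  ultimately show ?case by (simp only: phase_def image_mset_add_mset sum_mset.add_mset eq)
qed

text \<open>The phase difference \<open>D\<close> is the argument of \<open>g / f\<close>, so \<open>sin D > 0\<close>; it is continuous and
  vanishes at infinity, hence cannot leave \<open>(0, \<pi>)\<close>.\<close>

lemma phase_diff_bounds:
  assumes pos: "\<And>z. Im z > 0 \<Longrightarrow> Im (poly (cpoly (\<Prod>\<beta>\<in>#B. [:- \<beta>, 1:])) z
      / poly (cpoly (\<Prod>\<alpha>\<in>#A. [:- \<alpha>, 1:])) z) > 0"
    and "y > 0"
  shows "0 < phase B y t - phase A y t \<and> phase B y t - phase A y t < pi"
proof -
  define D where "D = (\<lambda>t. phase B y t - phase A y t)"
  have sin: "sin (D t) > 0" for t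
  proof -
    let ?z = "Complex t y"
    obtain r where r: "r > 0"
      "poly (cpoly (\<Prod>\<alpha>\<in>#A. [:- \<alpha>, 1:])) ?z = complex_of_real r * cis (phase A y t)"
      using poly_prod_linear_polar[OF \<open>y > 0\<close>] by blast
    obtain s where s: "s > 0"
      "poly (cpoly (\<Prod>\<alpha>\<in>#B. [:- \<alpha>, 1:])) ?z = complex_of_real s * cis (phase B y t)"
      using poly_prod_linear_polar[OF \<open>y > 0\<close>] by blast
    have "Im (complex_of_real (s / r) * cis (D t)) > 0"
      using pos[of ?z] \<open>y > 0\<close> unfolding r s D_def cis_divide[symmetric] by simp
    then show ?thesis using r s by (simp add: zero_less_divide_iff zero_less_mult_iff)
  qed
  have lim: "(D \<longlongrightarrow> 0) at_top"
    unfolding D_def using tendsto_diff[OF phase_at_top phase_at_top] \<open>y > 0\<close> by fastforce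
  have cont: "continuous_on S D" for S
    unfolding D_def by (intro continuous_intros continuous_on_phase)
  have "0 < D t"
  proof (rule ccontr)
    assume "\<not> 0 < D t"
    \<comment> \<open>The sine is nonpositive on \<open>[- pi, 0]\<close>. The crossing is sought at
      \<open>- pi\<close> rather than 0 because \<open>D\<close> could approach its limit 0 from
      below without reaching it.\<close>
    have "D t < - pi"
    proof (rule ccontr)
      assume "\<not> D t < - pi"
      then have "sin (- D t) \<ge> 0" using \<open>\<not> 0 < D t\<close> by (intro sin_ge_zero) auto
      then show False using sin[of t] by simp
    qed
    have "eventually (\<lambda>s. - pi < D s \<and> t \<le> s) at_top"
      by (intro eventually_conj order_tendstoD[OF lim] eventually_ge_at_top) simp
    then obtain s where "- pi < D s" "t \<le> s" by (auto simp: eventually_at_top_linorder)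
    then obtain x where "D x = - pi"
      using IVT'[of D t "- pi" s] \<open>D t < - pi\<close> cont by force
    then show False using sin[of x] by simp
  qed
  moreover have "D t < pi"
  proof (rule ccontr)
    assume "\<not> D t < pi"
    have "eventually (\<lambda>s. D s < pi \<and> t \<le> s) at_top"
      by (intro eventually_conj order_tendstoD[OF lim] eventually_ge_at_top) simp
    then obtain s where "D s < pi" "t \<le> s" by (auto simp: eventually_at_top_linorder)
    then obtain x where "D x = pi"
      using IVT2'[of D s pi t] \<open>\<not> D t < pi\<close> cont by force
    then show False using sin[of x] by simp
  qed
  ultimately show ?thesis by (simp add: D_def)
qed

text \<open>Letting the point tend to \<open>t\<close> turns the phase bounds into
  \<open>0 \<le> pi * d \<le> pi\<close>, where \<open>d\<close> is the difference of the two
  counts.\<close>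

lemma count_zeros_above_bounds:
  assumes pos: "\<And>z. Im z > 0 \<Longrightarrow> Im (poly (cpoly (\<Prod>\<beta>\<in>#B. [:- \<beta>, 1:])) z
      / poly (cpoly (\<Prod>\<alpha>\<in>#A. [:- \<alpha>, 1:])) z) > 0"
  shows "size (filter_mset (\<lambda>\<alpha>. t < \<alpha>) A) \<le> size (filter_mset (\<lambda>\<beta>. t < \<beta>) B)"
    and "size (filter_mset (\<lambda>\<beta>. t < \<beta>) B) \<le> size (filter_mset (\<lambda>\<alpha>. t < \<alpha>) A) + 1"
proof -
  let ?N = "\<lambda>A. size (filter_mset (\<lambda>\<alpha>. t < \<alpha>) A)"
  let ?D = "\<lambda>n. phase B (inverse ((real n)\<^sup>2)) (t + inverse (real n)) -
    phase A (inverse ((real n)\<^sup>2)) (t + inverse (real n))"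
  have lim: "?D \<longlonglongrightarrow> pi * real (?N B) - pi * real (?N A)"
    by (intro tendsto_diff phase_limit)
  \<comment> \<open>For \<open>n = 0\<close> the height \<open>inverse 0\<close> is 0, outside the
    open half plane.\<close>
  have D: "0 \<le> ?D n \<and> ?D n \<le> pi" if "n \<ge> 1" for n
    using phase_diff_bounds[OF pos, of "inverse ((real n)\<^sup>2)"] that by (simp add: less_imp_le)
  have "0 \<le> pi * real (?N B) - pi * real (?N A)"
    using D by (intro LIMSEQ_le_const[OF lim]) blast
  then show "?N A \<le> ?N B" by simp
  have "pi * real (?N B) - pi * real (?N A) \<le> pi"
    using D by (intro LIMSEQ_le_const2[OF lim]) blast
  then have "pi * real (?N B) \<le> pi * real (?N A + 1)" by (simp add: algebra_simps)
  then show "?N B \<le> ?N A + 1" by (subst (asm) mult_le_cancel_left_pos) auto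
qed

section \<open>Interlacing of sorted lists from counts above a threshold\<close>

lemma length_filter_greater_ge:
  assumes "sorted xs" "i < length xs" "t < xs ! i"
  shows "length xs - i \<le> length (filter (\<lambda>x. t < x) xs)"
proof -
  have "t < x" if x: "x \<in> set (drop i xs)" for x
  proof -
    obtain j where j: "j < length (drop i xs)" "x = drop i xs ! j"
      using x unfolding in_set_conv_nth by blast
    then have "xs ! i \<le> x" using sorted_nth_mono[OF assms(1), of i "i + j"] by simp
    then show ?thesis using assms(3) by simp
  qed
  then have "filter (\<lambda>x. t < x) (drop i xs) = drop i xs" by (simp add: filter_True)
  then have "length xs - i = length (filter (\<lambda>x. t < x) (drop i xs))" by simp
  also have "\<dots> \<le> length (filter (\<lambda>x. t < x) (take i xs @ drop i xs))"
    by (simp only: filter_append length_append)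
  finally show ?thesis by (simp only: append_take_drop_id)
qed

lemma length_filter_greater_le:
  assumes "sorted xs" "i < length xs" "xs ! i \<le> t"
  shows "length (filter (\<lambda>x. t < x) xs) \<le> length xs - Suc i"
proof -
  have "\<not> t < x" if x: "x \<in> set (take (Suc i) xs)" for x
  proof -
    obtain j where j: "j < length (take (Suc i) xs)" "x = take (Suc i) xs ! j"
      using x unfolding in_set_conv_nth by blast
    then have "x \<le> xs ! i" using sorted_nth_mono[OF assms(1), of j i] assms(2) by simp
    then show ?thesis using assms(3) by simp
  qed
  then have "filter (\<lambda>x. t < x) (take (Suc i) xs) = []" by (simp add: filter_False)
  then have "length (filter (\<lambda>x. t < x) (take (Suc i) xs @ drop (Suc i) xs))
      = length (filter (\<lambda>x. t < x) (drop (Suc i) xs))"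
    by (simp only: filter_append) simp
  also have "\<dots> \<le> length (drop (Suc i) xs)" by (rule length_filter_le)
  finally show ?thesis by (simp only: append_take_drop_id length_drop)
qed

lemma interlace_of_counts:
  fixes xs ys :: "real list"
  assumes "sorted xs" "sorted ys" and len: "length ys = length xs + 1"
    and lower: "\<And>t. length (filter (\<lambda>x. t < x) xs) \<le> length (filter (\<lambda>x. t < x) ys)"
    and upper: "\<And>t. length (filter (\<lambda>x. t < x) ys) \<le> length (filter (\<lambda>x. t < x) xs) + 1"
    and i: "i < length xs"
  shows "ys ! i \<le> xs ! i \<and> xs ! i \<le> ys ! (i + 1)"
proof (intro conjI)
  show "ys ! i \<le> xs ! i"
  proof (rule ccontr)
    assume "\<not> ys ! i \<le> xs ! i"
    \<comment> \<open>Above the threshold \<open>xs ! i\<close> lie at least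
      \<open>length xs + 1 - i\<close> entries of \<open>ys\<close> but at most
      \<open>length xs - i - 1\<close> of \<open>xs\<close>, a gap of two.\<close>
    then show False
      using length_filter_greater_ge[OF \<open>sorted ys\<close>, of i "xs ! i"]
        length_filter_greater_le[OF \<open>sorted xs\<close> i, of "xs ! i"] upper[of "xs ! i"] len i
      by simp
  qed
  show "xs ! i \<le> ys ! (i + 1)"
  proof (rule ccontr)
    assume "\<not> xs ! i \<le> ys ! (i + 1)"
    \<comment> \<open>Above the threshold \<open>ys ! (i + 1)\<close> lie at least
      \<open>length xs - i\<close> entries of \<open>xs\<close> but at most
      \<open>length xs - i - 1\<close> of \<open>ys\<close>.\<close>
    then show False
      using length_filter_greater_ge[OF \<open>sorted xs\<close> i, of "ys ! (i + 1)"]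
        length_filter_greater_le[OF \<open>sorted ys\<close>, of "i + 1" "ys ! (i + 1)"] lower[of "ys ! (i + 1)"] len i
      by simp
  qed
qed


lemma size_proots_real_rooted:
  assumes "real_rooted p" "lead_coeff p = 1"
  shows "size (proots p) = degree p"
proof -
  have "degree (\<Prod>\<alpha>\<in>#A. [:- \<alpha>, 1:]) = size A" for A :: "real multiset"
  proof (induction A)
    case (add a A)
    have "(\<Prod>\<alpha>\<in>#A. [:- \<alpha>, 1:]) \<noteq> (0 :: real poly)" by auto
    then have "degree ([:- a, 1:] * (\<Prod>\<alpha>\<in>#A. [:- \<alpha>, 1:])) = Suc (size A)"
      using add by (subst degree_mult_eq) auto
    then show ?case by (simp del: mult_pCons_left)
  qed simp
  then show ?thesis using real_rooted_eq_prod_proots[OF assms] by metis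
qed

lemma poly_nonneg_above_zeros:
  assumes "real_rooted p" "lead_coeff p = 1" "\<And>x. poly p x = 0 \<Longrightarrow> x \<le> b"
  shows "poly p b \<ge> 0"
proof -
  define A where "A = proots p"
  have p: "p = (\<Prod>\<alpha>\<in>#A. [:- \<alpha>, 1:])"
    unfolding A_def by (rule real_rooted_eq_prod_proots[OF assms(1,2)])
  have "p \<noteq> 0" using assms(2) by auto
  then have "\<forall>\<alpha>\<in>#A. \<alpha> \<le> b" using assms(3) by (auto simp: A_def)
  then have "poly (\<Prod>\<alpha>\<in>#A. [:- \<alpha>, 1:]) b \<ge> 0"
    by (induction A) (auto simp: algebra_simps mult_right_mono)
  then show ?thesis using p by simp
qed

lemma mset_zeros: "mset (zeros p) = proots p"
  by (simp add: zeros_def)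

lemma length_filter_zeros: "length (filter P (zeros p)) = size (filter_mset P (proots p))"
  unfolding mset_zeros[symmetric] mset_filter[symmetric] size_mset ..

lemma Im_inverse_nonpos: "Im w > 0 \<Longrightarrow> Im (inverse w) \<le> 0"
  by (simp add: divide_nonpos_nonneg)

section \<open>The vertex recurrence for \<open>pl\<close>\<close>

locale laplacian_matching =
  fixes G :: "'a graph"
  assumes simple: "simple_graph G"
begin

text \<open>Degrees are those in \<open>G\<close> for every \<open>S\<close>, so deleting vertices
  leaves the linear factors of the others unchanged.\<close>

abbreviation pl :: "'a set \<Rightarrow> real poly" where
  "pl S \<equiv> plmp G (induced G S)"

abbreviation linear_at :: "'a \<Rightarrow> real poly" where
  "linear_at v \<equiv> [:- real (degree_in G v), 1:]"

abbreviation nbrs :: "'a set \<Rightarrow> 'a \<Rightarrow> 'a set" where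
  "nbrs S v \<equiv> {u \<in> S. {v, u} \<in> edges G}"

lemma finite_subset_verts: "S \<subseteq> verts G \<Longrightarrow> finite S"
  using simple by (auto simp: simple_graph_def intro: finite_subset)

lemma edge_neq: "{v, u} \<in> edges G \<Longrightarrow> u \<noteq> v"
  using simple by (auto simp: simple_graph_def)

lemma edge_cases:
  assumes "e \<in> edges G" "v \<in> e"
  obtains u where "e = {v, u}"
proof -
  obtain a b where "e = {a, b}"
    using simple assms(1) by (auto simp: simple_graph_def card_2_iff)
  then show ?thesis using assms(2) that by (metis insert_commute insertE singletonD)
qed

lemma matchings_induced:
  "matchings (induced G S) = {M. M \<subseteq> edges G \<and> \<Union>M \<subseteq> S \<and> (\<forall>e\<in>M. \<forall>f\<in>M. e \<noteq> f \<longrightarrow> e \<inter> f = {})}"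
  by (auto simp: matchings_def induced_def)

lemma finite_matchings: "finite S \<Longrightarrow> finite (matchings (induced G S))"
  by (rule finite_subset[of _ "Pow (Pow S)"]) (auto simp: matchings_induced)

lemma pl_eq: "pl S = (\<Sum>M\<in>matchings (induced G S). (- 1) ^ card M * (\<Prod>v\<in>S - \<Union>M. linear_at v))"
  by (simp add: plmp_def induced_def)

lemma pl_empty: "pl {} = 1"
proof -
  have "matchings (induced G {}) = {{}}"
    using simple by (fastforce simp: matchings_induced simple_graph_def)
  then show ?thesis by (simp add: pl_eq)
qed

text \<open>Either \<open>v\<close> is unmatched, or it is matched to one neighbour \<open>u\<close>
  and disjointness keeps all other edges away from both.\<close>

lemma matchings_split:
  assumes "v \<in> S"
  shows "matchings (induced G S) = matchings (induced G (S - {v})) \<union>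
    (\<Union>u\<in>nbrs S v. insert {v, u} ` matchings (induced G (S - {v} - {u})))" (is "?L = ?A \<union> ?B")
proof
  show "?L \<subseteq> ?A \<union> ?B"
  proof
    fix M assume M: "M \<in> ?L"
    show "M \<in> ?A \<union> ?B"
    proof (cases "v \<in> \<Union>M")
      case False
      then show ?thesis using M by (auto simp: matchings_induced)
    next
      case True
      then obtain e where e: "e \<in> M" "v \<in> e" by blast
      then have "e \<in> edges G" using M by (auto simp: matchings_induced)
      then obtain u where u: "e = {v, u}" using e edge_cases by blast
      have "M - {e} \<in> matchings (induced G (S - {v} - {u}))"
      proof -
        have "f \<inter> e = {}" if "f \<in> M" "f \<noteq> e" for f
          using M e that by (simp add: matchings_induced)
        then have "\<Union>(M - {e}) \<inter> e = {}" by blast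
        then have "\<Union>(M - {e}) \<subseteq> S - {v} - {u}" using M u by (auto simp: matchings_induced)
        then show ?thesis using M by (simp add: matchings_induced subset_iff)
      qed
      moreover have "M = insert {v, u} (M - {e})" using e u by blast
      moreover have "u \<in> nbrs S v" using M e u by (auto simp: matchings_induced)
      ultimately show ?thesis by blast
    qed
  qed
  have "insert {v, u} M \<in> ?L" if u: "u \<in> nbrs S v" and M: "M \<in> matchings (induced G (S - {v} - {u}))" for u M
  proof -
    have "{v, u} \<inter> f = {}" if "f \<in> M" for f
      using M that by (auto simp: matchings_induced)
    then have "\<forall>e\<in>insert {v, u} M. \<forall>f\<in>insert {v, u} M. e \<noteq> f \<longrightarrow> e \<inter> f = {}"
      using M by (simp add: matchings_induced Int_commute)
    then show ?thesis using assms u M by (auto simp: matchings_induced)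
  qed
  moreover have "?A \<subseteq> ?L" by (auto simp: matchings_induced)
  ultimately show "?A \<union> ?B \<subseteq> ?L" by blast
qed

lemma pl_rec:
  assumes S: "S \<subseteq> verts G" and v: "v \<in> S"
  shows "pl S = linear_at v * pl (S - {v}) - (\<Sum>u\<in>nbrs S v. pl (S - {v} - {u}))"
proof -
  define T where "T = (\<lambda>S M. (- 1) ^ card M * (\<Prod>v\<in>S - \<Union>M. linear_at v))"
  let ?m = "\<lambda>S. matchings (induced G S)"
  have pl_T: "pl U = sum (T U) (?m U)" for U by (simp only: pl_eq T_def)
  let ?I = "\<lambda>u. insert {v, u} ` ?m (S - {v} - {u})"
  have fin: "finite S" by (rule finite_subset_verts[OF S])
  have finm: "finite (?m U)" if "U \<subseteq> S" for U
    using that fin by (intro finite_matchings) (rule finite_subset)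
  have notin: "v \<notin> \<Union>M" "u \<notin> \<Union>M" if "M \<in> ?m (S - {v} - {u})" for M u
    using that unfolding matchings_induced by blast+
  have A: "T S M = linear_at v * T (S - {v}) M" if "M \<in> ?m (S - {v})" for M
  proof -
    have "v \<notin> \<Union>M" using that unfolding matchings_induced by blast
    then have "S - \<Union>M = insert v (S - {v} - \<Union>M)" using v by blast
    then show ?thesis using fin by (simp add: T_def del: mult_pCons_left)
  qed
  \<comment> \<open>The extra edge changes the sign and removes exactly \<open>v\<close> and
    \<open>u\<close> from the vertex product.\<close>
  have B: "T S (insert {v, u} M) = - T (S - {v} - {u}) M" if M: "M \<in> ?m (S - {v} - {u})" for u M
  proof -
    have "M \<subseteq> Pow S" using M by (auto simp: matchings_induced)
    then have "finite M" using fin finite_subset by blast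
    moreover have "{v, u} \<notin> M" using notin[OF M] by blast
    moreover have "S - \<Union>(insert {v, u} M) = S - {v} - {u} - \<Union>M" by blast
    ultimately show ?thesis by (simp add: T_def)
  qed
  have inj: "inj_on (insert {v, u}) (?m (S - {v} - {u}))" for u
  proof (rule inj_onI)
    fix M N
    assume MN: "M \<in> ?m (S - {v} - {u})" "N \<in> ?m (S - {v} - {u})"
      and eq: "insert {v, u} M = insert {v, u} N"
    have "{v, u} \<notin> M" "{v, u} \<notin> N" using notin(1)[OF MN(1)] notin(1)[OF MN(2)] by blast+
    then show "M = N" using eq by (simp add: insert_ident)
  qed
  \<comment> \<open>The partner of \<open>v\<close> determines the class: otherwise
    \<open>{v, u'}\<close> would be an edge of \<open>M\<close>, which avoids
    \<open>v\<close>.\<close>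
  have disj: "?I u \<inter> ?I u' = {}" if "u \<noteq> u'" for u u'
  proof (rule ccontr)
    assume "?I u \<inter> ?I u' \<noteq> {}"
    then obtain M N where M: "M \<in> ?m (S - {v} - {u})" and "insert {v, u} M = insert {v, u'} N" by blast
    then have "{v, u'} \<in> M" using that by (metis doubleton_eq_iff insertE insertI1)
    then show False using notin[OF M] by blast
  qed
  have "pl S = sum (T S) (?m (S - {v}) \<union> (\<Union>u\<in>nbrs S v. ?I u))"
    unfolding pl_T matchings_split[OF v] ..
  also have "\<dots> = sum (T S) (?m (S - {v})) + sum (T S) (\<Union>u\<in>nbrs S v. ?I u)"
  proof (rule sum.union_disjoint)
    show "finite (?m (S - {v}))" by (rule finm) blast
    show "finite (\<Union>u\<in>nbrs S v. ?I u)" using fin by (intro finite_UN_I finite_imageI finm) auto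
    show "?m (S - {v}) \<inter> (\<Union>u\<in>nbrs S v. ?I u) = {}" by (auto simp: matchings_induced)
  qed
  also have "sum (T S) (?m (S - {v})) = linear_at v * pl (S - {v})"
    unfolding pl_T sum_distrib_left by (rule sum.cong[OF refl A])
  also have "sum (T S) (\<Union>u\<in>nbrs S v. ?I u) = (\<Sum>u\<in>nbrs S v. sum (T S) (?I u))"
  proof (rule sum.UNION_disjoint)
    show "finite (nbrs S v)" using fin by simp
    show "\<forall>u\<in>nbrs S v. finite (?I u)" by (intro ballI finite_imageI finm) blast
    show "\<forall>u\<in>nbrs S v. \<forall>u'\<in>nbrs S v. u \<noteq> u' \<longrightarrow> ?I u \<inter> ?I u' = {}" using disj by blast
  qed
  also have "\<dots> = (\<Sum>u\<in>nbrs S v. - pl (S - {v} - {u}))"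
  proof (rule sum.cong[OF refl])
    fix u
    have "sum (T S) (?I u) = (\<Sum>M\<in>?m (S - {v} - {u}). T S (insert {v, u} M))"
      by (simp add: sum.reindex[OF inj])
    also have "\<dots> = (\<Sum>M\<in>?m (S - {v} - {u}). - T (S - {v} - {u}) M)"
      by (rule sum.cong[OF refl B])
    finally show "sum (T S) (?I u) = - pl (S - {v} - {u})"
      by (simp add: sum_negf pl_T)
  qed
  finally show ?thesis by (simp add: sum_negf)
qed

text \<open>The leading term comes from the linear factor times \<open>pl (S - {v})\<close>; the
  subtracted terms have degree below \<open>card S\<close>.\<close>

lemma degree_pl_and_monic:
  "S \<subseteq> verts G \<Longrightarrow> degree (pl S) = card S \<and> lead_coeff (pl S) = 1"
proof (induction "card S" arbitrary: S rule: less_induct)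
  case less
  have fin: "finite S" by (rule finite_subset_verts[OF less.prems])
  show ?case
  proof (cases "S = {}")
    case True
    then show ?thesis by (simp add: pl_empty)
  next
    case False
    then obtain v where v: "v \<in> S" by blast
    have "card (S - {v}) < card S" using fin v by (rule card_Diff1_less)
    with less have IH: "degree (pl (S - {v})) = card (S - {v})" "lead_coeff (pl (S - {v})) = 1"
      by blast+
    let ?p = "linear_at v * pl (S - {v})" and ?q = "\<Sum>u\<in>nbrs S v. pl (S - {v} - {u})"
    have "card S > 0" using fin v by (auto simp: card_gt_0_iff)
    have "degree ?q < card S"
    proof (rule degree_sum_less)
      fix u assume "u \<in> nbrs S v"
      have "card (S - {v} - {u}) \<le> card (S - {v})" using fin by (intro card_mono) auto
      then have "card (S - {v} - {u}) < card S" using \<open>card (S - {v}) < card S\<close> by simp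
      with less show "degree (pl (S - {v} - {u})) < card S" by (metis Diff_subset order_trans)
    qed fact
    have "pl (S - {v}) \<noteq> 0" using IH(2) by auto
    then have "degree ?p = Suc (card (S - {v}))" using IH(1) by (subst degree_mult_eq) auto
    also have "\<dots> = card S" using card.remove[OF fin v] by simp
    finally have p: "degree ?p = card S" .
    have "lead_coeff ?p = 1" using IH(2) by (simp only: lead_coeff_mult) simp
    have "degree (?p - ?q) = card S"
      using degree_add_eq_left[of "- ?q" ?p] p \<open>degree ?q < card S\<close>
      by (simp del: mult_pCons_left)
    moreover have "coeff (?p - ?q) (card S) = 1"
      using \<open>lead_coeff ?p = 1\<close> \<open>degree ?q < card S\<close> p
      by (simp add: coeff_eq_0 del: mult_pCons_left)
    ultimately show ?thesis using pl_rec[OF less.prems v] by (simp del: mult_pCons_left)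
  qed
qed

lemmas degree_pl = degree_pl_and_monic[THEN conjunct1]
  and monic_pl = degree_pl_and_monic[THEN conjunct2]

text \<open>Dividing the recurrence by \<open>pl (S - {v})\<close> gives a continued fraction, each level of which maps
  the upper half plane to itself because \<open>w \<mapsto> - 1 / w\<close> does.\<close>

lemma pl_upper_half_plane:
  assumes z: "Im z > 0"
  shows "S \<subseteq> verts G \<Longrightarrow> poly (cpoly (pl S)) z \<noteq> 0 \<and>
    (\<forall>v\<in>S. Im (poly (cpoly (pl S)) z / poly (cpoly (pl (S - {v}))) z) > 0)"
proof (induction "card S" arbitrary: S rule: less_induct)
  case less
  have fin: "finite S" by (rule finite_subset_verts[OF less.prems])
  define P where "P = (\<lambda>S. poly (cpoly (pl S)) z)"
  have main: "Im (P S / P (S - {v})) > 0" if v: "v \<in> S" for v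
  proof -
    have "card (S - {v}) < card S" using fin v by (rule card_Diff1_less)
    with less have IH: "P (S - {v}) \<noteq> 0"
      "\<And>u. u \<in> S - {v} \<Longrightarrow> Im (P (S - {v}) / P (S - {v} - {u})) > 0"
      unfolding P_def by (meson Diff_subset order_trans)+
    have "P S = (z - real (degree_in G v)) * P (S - {v}) - (\<Sum>u\<in>nbrs S v. P (S - {v} - {u}))"
      unfolding P_def pl_rec[OF less.prems v] cpoly_diff cpoly_mult cpoly_sum cpoly_linear
      by (simp add: poly_sum algebra_simps)
    then have "P S / P (S - {v}) =
        z - real (degree_in G v) - (\<Sum>u\<in>nbrs S v. P (S - {v} - {u}) / P (S - {v}))"
      using IH(1) by (simp add: diff_divide_distrib sum_divide_distrib)
    then have eq: "Im (P S / P (S - {v})) =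
        Im z - (\<Sum>u\<in>nbrs S v. Im (P (S - {v} - {u}) / P (S - {v})))"
      by (simp add: Im_sum)
    \<comment> \<open>Each summand involves the reciprocal of a quotient from the induction
      hypothesis.\<close>
    have "(\<Sum>u\<in>nbrs S v. Im (P (S - {v} - {u}) / P (S - {v}))) \<le> 0"
    proof (rule sum_nonpos)
      fix u assume "u \<in> nbrs S v"
      then have "u \<in> S - {v}" using edge_neq by blast
      from IH(2)[OF this] show "Im (P (S - {v} - {u}) / P (S - {v})) \<le> 0"
        using Im_inverse_nonpos[of "P (S - {v}) / P (S - {v} - {u})"] by (simp add: inverse_eq_divide)
    qed
    then show ?thesis using eq z by simp
  qed
  have "P S \<noteq> 0"
  proof (cases "S = {}")
    case True
    then show ?thesis by (simp add: P_def pl_empty)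
  next
    case False
    \<comment> \<open>Were \<open>P S\<close> zero, the quotient would be 0 and could not have
      positive imaginary part.\<close>
    then show ?thesis using main by fastforce
  qed
  then show ?case using main by (simp add: P_def)
qed

section \<open>Real-rootedness and interlacing for \<open>pl\<close>\<close>

lemma real_rooted_pl: "S \<subseteq> verts G \<Longrightarrow> real_rooted (pl S)"
  using pl_upper_half_plane by (intro real_rootedI) blast

lemma count_zeros_above_pl:
  assumes S: "S \<subseteq> verts G" and v: "v \<in> S"
  shows "size (filter_mset (\<lambda>\<alpha>. t < \<alpha>) (proots (pl (S - {v})))) \<le> size (filter_mset (\<lambda>\<beta>. t < \<beta>) (proots (pl S)))"
    and "size (filter_mset (\<lambda>\<beta>. t < \<beta>) (proots (pl S))) \<le> size (filter_mset (\<lambda>\<alpha>. t < \<alpha>) (proots (pl (S - {v})))) + 1"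
proof -
  have S': "S - {v} \<subseteq> verts G" using S by blast
  have "Im (poly (cpoly (\<Prod>\<beta>\<in>#proots (pl S). [:- \<beta>, 1:])) z
      / poly (cpoly (\<Prod>\<alpha>\<in>#proots (pl (S - {v})). [:- \<alpha>, 1:])) z) > 0" if "Im z > 0" for z
    using pl_upper_half_plane[OF that S] v
    unfolding real_rooted_eq_prod_proots[OF real_rooted_pl[OF S] monic_pl[OF S], symmetric]
      real_rooted_eq_prod_proots[OF real_rooted_pl[OF S'] monic_pl[OF S'], symmetric] by blast
  note bounds = count_zeros_above_bounds[OF this]
  show "size (filter_mset (\<lambda>\<alpha>. t < \<alpha>) (proots (pl (S - {v})))) \<le> size (filter_mset (\<lambda>\<beta>. t < \<beta>) (proots (pl S)))"
    by (rule bounds(1))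
  show "size (filter_mset (\<lambda>\<beta>. t < \<beta>) (proots (pl S))) \<le> size (filter_mset (\<lambda>\<alpha>. t < \<alpha>) (proots (pl (S - {v})))) + 1"
    by (rule bounds(2))
qed

lemma length_zeros_pl:
  assumes "S \<subseteq> verts G"
  shows "length (zeros (pl S)) = card S"
proof -
  have "length (zeros (pl S)) = size (proots (pl S))" by (simp flip: size_mset mset_zeros)
  then show ?thesis
    using size_proots_real_rooted[OF real_rooted_pl monic_pl] degree_pl assms by simp
qed

lemma interlace_pl:
  assumes S: "S \<subseteq> verts G" and v: "v \<in> S"
  shows "interlace (pl (S - {v})) (pl S)"
proof -
  have S': "S - {v} \<subseteq> verts G" using S by blast
  have len: "length (zeros (pl S)) = length (zeros (pl (S - {v}))) + 1"
    using card.remove[OF finite_subset_verts[OF S] v] length_zeros_pl[OF S] length_zeros_pl[OF S'] by simp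
  have "zeros (pl S) ! i \<le> zeros (pl (S - {v})) ! i \<and> zeros (pl (S - {v})) ! i \<le> zeros (pl S) ! (i + 1)"
    if "i < length (zeros (pl (S - {v})))" for i
    by (rule interlace_of_counts[OF _ _ len _ _ that])
      (simp_all only: length_filter_zeros count_zeros_above_pl[OF S v], simp_all add: zeros_def)
  then show ?thesis
    using len real_rooted_pl[OF S] real_rooted_pl[OF S'] by (simp add: interlace_def)
qed

section \<open>Upper bounds on zeros and the largest zero\<close>

lemma pl_nonzero: "S \<subseteq> verts G \<Longrightarrow> pl S \<noteq> 0"
  using real_rooted_pl by (auto simp: real_rooted_def)

text \<open>Bounds are expressed as empty counts, so that the counting inequalities apply and
  polynomials without zeros are covered.\<close>

lemma zeros_bound_iff:
  assumes "S \<subseteq> verts G"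
  shows "(\<forall>x. poly (pl S) x = 0 \<longrightarrow> x \<le> b) \<longleftrightarrow> size (filter_mset (\<lambda>x. b < x) (proots (pl S))) = 0"
  by (simp only: size_eq_0_iff_empty filter_mset_eq_mempty_iff not_less
      set_count_proots[OF pl_nonzero[OF assms]] mem_Collect_eq)

text \<open>Vertices are deleted one at a time; the count above \<open>b\<close> cannot grow from 0
  at any deletion.\<close>

lemma zeros_bound_Diff:
  assumes S: "S \<subseteq> verts G" and b: "\<forall>x. poly (pl S) x = 0 \<longrightarrow> x \<le> b" and "finite D"
  shows "\<forall>x. poly (pl (S - D)) x = 0 \<longrightarrow> x \<le> b"
  using \<open>finite D\<close>
proof induction
  case empty
  then show ?case using b by simp
next
  case (insert d D)
  have U: "S - D \<subseteq> verts G" "S - D - {d} \<subseteq> verts G" using S by blast+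
  have "S - insert d D = S - D - {d}" by blast
  moreover have "\<forall>x. poly (pl (S - D - {d})) x = 0 \<longrightarrow> x \<le> b"
  proof (cases "d \<in> S - D")
    case True
    have "size (filter_mset (\<lambda>x. b < x) (proots (pl (S - D)))) = 0"
      using insert.IH zeros_bound_iff[OF U(1)] by blast
    then have "size (filter_mset (\<lambda>x. b < x) (proots (pl (S - D - {d})))) = 0"
      using count_zeros_above_pl(1)[OF U(1) True, of b] by linarith
    then show ?thesis using zeros_bound_iff[OF U(2)] by blast
  next
    case False
    then show ?thesis using insert.IH by simp
  qed
  ultimately show ?case by simp
qed

lemma zeros_bound_subset:
  assumes "S \<subseteq> verts G" "\<forall>x. poly (pl S) x = 0 \<longrightarrow> x \<le> b" "T \<subseteq> S"
  shows "\<forall>x. poly (pl T) x = 0 \<longrightarrow> x \<le> b"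
  using zeros_bound_Diff[OF assms(1,2), of "S - T"] assms(3) finite_subset_verts[OF assms(1)]
  by (simp add: double_diff)

text \<open>If the upper bound \<open>b\<close> were a zero for a proper subset of \<open>S\<close>, take a minimal such set \<open>T\<close>. For
  \<open>x\<close> outside \<open>T\<close>, the recurrence at \<open>x\<close> shows that the value for \<open>insert x T\<close> at \<open>b\<close> is minus the
  sum of the positive values for \<open>T - {u}\<close> over the neighbours \<open>u\<close> of \<open>x\<close>. This value is not
  negative, so there are no such neighbours and \<open>T\<close> is a union of components of \<open>S\<close>.\<close>

lemma bound_not_zero_of_connected:
  assumes S: "S \<subseteq> verts G" and v: "v \<in> S" and conn: "connected_graph (induced G S)"
    and b: "\<forall>x. poly (pl S) x = 0 \<longrightarrow> x \<le> b"
  shows "poly (pl (S - {v})) b \<noteq> 0"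
proof
  assume "poly (pl (S - {v})) b = 0"
  then have "S - {v} \<subseteq> S - {v} \<and> poly (pl (S - {v})) b = 0" by simp
  from ex_has_least_nat[of "\<lambda>T. T \<subseteq> S - {v} \<and> poly (pl T) b = 0", OF this, of card]
  obtain T where T: "T \<subseteq> S - {v}" "poly (pl T) b = 0"
    and min: "\<And>U. U \<subseteq> S - {v} \<Longrightarrow> poly (pl U) b = 0 \<Longrightarrow> card T \<le> card U"
    by blast
  have nonneg: "poly (pl U) b \<ge> 0" if "U \<subseteq> S" for U
  proof -
    have "U \<subseteq> verts G" using that S by blast
    then show ?thesis
      using zeros_bound_subset[OF S b that]
      by (intro poly_nonneg_above_zeros real_rooted_pl monic_pl) auto
  qed
  \<comment> \<open>Minimality of \<open>T\<close> excludes the value 0.\<close>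
  have pos: "poly (pl (T - {u})) b > 0" if "u \<in> T" for u
  proof -
    have "finite T" using T S by (intro finite_subset_verts) blast
    then have "card (T - {u}) < card T" using that by (rule card_Diff1_less)
    then have "poly (pl (T - {u})) b \<noteq> 0" using min[of "T - {u}"] T(1) by fastforce
    moreover have "poly (pl (T - {u})) b \<ge> 0" using T by (intro nonneg) blast
    ultimately show ?thesis by simp
  qed
  have closed: "y \<in> T" if "x \<in> T" "y \<in> S" "{x, y} \<in> edges G" for x y
  proof (rule ccontr)
    assume y: "y \<notin> T"
    have U: "insert y T \<subseteq> S" using T that by blast
    have eq: "insert y T - {y} = T" using y by blast
    have nb: "nbrs (insert y T) y = nbrs T y" using edge_neq by blast
    have "insert y T \<subseteq> verts G" using U S by blast
    from pl_rec[OF this insertI1]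
    have "pl (insert y T) = linear_at y * pl T - (\<Sum>u\<in>nbrs T y. pl (T - {u}))"
      unfolding eq nb .
    then have "poly (pl (insert y T)) b = - (\<Sum>u\<in>nbrs T y. poly (pl (T - {u})) b)"
      using T(2) by (simp add: poly_sum)
    moreover have "(\<Sum>u\<in>nbrs T y. poly (pl (T - {u})) b) > 0"
    proof (rule sum_pos)
      have "finite T" using T(1) S by (intro finite_subset_verts) blast
      then show "finite (nbrs T y)" by simp
      show "nbrs T y \<noteq> {}" using that by (auto simp: insert_commute)
    qed (use pos in blast)
    ultimately show False using nonneg[OF U] by simp
  qed
  have "T \<noteq> {}" using T(2) by (auto simp: pl_empty)
  then obtain w where w: "w \<in> T" by blast
  have "(w, v) \<in> {(a, b). {a, b} \<in> edges (induced G S)}\<^sup>*"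
    using conn w v T(1) by (auto simp: connected_graph_def induced_def)
  \<comment> \<open>\<open>T\<close> is closed under adjacency inside \<open>S\<close>, so a walk
    from \<open>w\<close> to \<open>v\<close> never leaves it.\<close>
  then have "v \<in> T"
  proof induction
    case base
    show ?case by (rule w)
  next
    case (step y z)
    then show ?case using closed[of y z] by (auto simp: induced_def)
  qed
  then show False using T(1) by blast
qed

text \<open>A nonempty \<open>S\<close> gives positive degree, hence a nonempty finite set of zeros
  on which \<open>Max\<close> is meaningful.\<close>

lemma largest_zero_pl:
  assumes S: "S \<subseteq> verts G" and "S \<noteq> {}"
  shows "poly (pl S) (largest_zero (pl S)) = 0"
    and "\<forall>x. poly (pl S) x = 0 \<longrightarrow> x \<le> largest_zero (pl S)"
proof -
  let ?Z = "{x. poly (pl S) x = 0}"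
  have fin: "finite ?Z" using pl_nonzero[OF S] by (rule poly_roots_finite)
  have "size (proots (pl S)) = card S"
    using size_proots_real_rooted real_rooted_pl[OF S] monic_pl[OF S] degree_pl[OF S] by metis
  moreover have "card S > 0" using assms finite_subset_verts[OF S] by (auto simp: card_gt_0_iff)
  ultimately have "proots (pl S) \<noteq> {#}" by auto
  then have "?Z \<noteq> {}" using pl_nonzero[OF S] by (auto simp: multiset_eq_iff order_root)
  then show "poly (pl S) (largest_zero (pl S)) = 0"
    using Max_in[OF fin] by (simp add: largest_zero_def)
  show "\<forall>x. poly (pl S) x = 0 \<longrightarrow> x \<le> largest_zero (pl S)"
    using Max_ge[OF fin] by (simp add: largest_zero_def)
qed

text \<open>By monotonicity of bounds the largest zero for \<open>S - {v}\<close> is at most that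
  for \<open>S\<close>, and the two differ because \<open>pl (S - {v})\<close> does not vanish at
  the latter. For empty \<open>S - {v}\<close> the polynomial would be 1, without zeros.\<close>

lemma largest_zero_less:
  assumes S: "S \<subseteq> verts G" and v: "v \<in> S" and conn: "connected_graph (induced G S)"
    and ne: "S - {v} \<noteq> {}"
  shows "largest_zero (pl (S - {v})) < largest_zero (pl S)"
proof -
  let ?b = "largest_zero (pl S)"
  have b: "\<forall>x. poly (pl S) x = 0 \<longrightarrow> x \<le> ?b" using largest_zero_pl(2)[OF S] v by blast
  have S': "S - {v} \<subseteq> verts G" using S by blast
  have "poly (pl (S - {v})) (largest_zero (pl (S - {v}))) = 0"
    by (rule largest_zero_pl(1)[OF S' ne])
  then show ?thesis
    using bound_not_zero_of_connected[OF S v conn b] zeros_bound_subset[OF S b, of "S - {v}"]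
    by (metis Diff_subset order_le_less)
qed

text \<open>Some \<open>t\<close> below the largest zero still bounds all zeros of
  \<open>pl (S - {v})\<close>. Hence at most one zero of \<open>pl S\<close>, counted with
  multiplicity, exceeds \<open>t\<close>.\<close>

lemma order_largest_zero:
  assumes S: "S \<subseteq> verts G" and v: "v \<in> S" and conn: "connected_graph (induced G S)"
  shows "order (largest_zero (pl S)) (pl S) = 1"
proof -
  let ?b = "largest_zero (pl S)"
  have S': "S - {v} \<subseteq> verts G" using S by blast
  obtain t where t: "t < ?b" "\<forall>x. poly (pl (S - {v})) x = 0 \<longrightarrow> x \<le> t"
  proof (cases "S - {v} = {}")
    case True
    show ?thesis by (rule that[of "?b - 1"]) (simp_all add: True pl_empty)
  next
    case False
    then show ?thesis using that largest_zero_less[OF S v conn] largest_zero_pl(2)[OF S'] by blast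
  qed
  have "order ?b (pl S) = count (filter_mset (\<lambda>x. t < x) (proots (pl S))) ?b"
    using pl_nonzero[OF S] t(1) by simp
  also have "\<dots> \<le> size (filter_mset (\<lambda>x. t < x) (proots (pl S)))" by (rule count_le_size)
  also have "\<dots> \<le> 1"
    using zeros_bound_iff[OF S', of t, THEN iffD1, OF t(2)] count_zeros_above_pl(2)[OF S v, of t] by linarith
  finally have "order ?b (pl S) \<le> 1" .
  moreover have "order ?b (pl S) \<noteq> 0"
    using largest_zero_pl(1)[OF S] v pl_nonzero[OF S] order_root by blast
  ultimately show ?thesis by simp
qed

end

theorem theorem3p1:
  fixes G H :: "'a graph" and v :: 'a
  assumes "simple_graph G" and "induced_subgraph H G" and "v \<in> verts H"
  shows "interlace (plmp G (induced G (verts H - {v}))) (plmp G H) \<and>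
    (connected_graph H \<longrightarrow>
       order (largest_zero (plmp G H)) (plmp G H) = 1 \<and>
       (verts H - {v} \<noteq> {} \<longrightarrow>
          largest_zero (plmp G (induced G (verts H - {v}))) < largest_zero (plmp G H)))"
proof -
  interpret laplacian_matching G by standard (rule assms(1))
  obtain S where S: "S \<subseteq> verts G" "H = induced G S" "verts H = S"
    using assms(2) unfolding induced_subgraph_def by blast
  then have "v \<in> S" using assms(3) by simp
  then show ?thesis
    using interlace_pl[OF S(1)] order_largest_zero[OF S(1)] largest_zero_less[OF S(1)]
    unfolding S(3) unfolding S(2) by blast
qed

end
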